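(* Let $\kappa$ be an infinite cardinal and let $\mathcal{B}$ be a bornology on $\kappa$ with $\kappa\notin\mathcal{B}$. Then the $\mathcal{B}$-macrocube $\{0,1\}^{\mathcal{B}}$ is a normal ballean if and only if $\mathcal{B}$ has a base that is linearly ordered by inclusion.
   Context: **Bornologies.** A bornology on a set $X$ is a family $\mathcal{B}$ of subsets of $X$ that contains all finite subsets of $X$ and is closed under finite unions and taking subsets. A subfamily $\mathcal{B}'\subseteq\mathcal{B}$ is a base for $\mathcal{B}$ if each $B\in\mathcal{B}$ is contained in some $B'\in\mathcal{B}'$. **Balleans.** A coarse structure on a set $X$ is a family $\mathcal{E}$ of subsets of $X\times X$ such that: each $E\in\mathcal{E}$ contains the diagonal $\triangle_X$; if $E,E'\in\mathcal{E}$ then $E\circ E'\in\mathcal{E}$ and $E^{-1}\in\mathcal{E}$, where $E\circ E'=\{(x,y):\exists z\ ((x,z)\in E,\ (z,y)\in E')\}$ and $E^{-1}=\{(y,x):(x,y)\in E\}$; and if $E\in\mathcal{E}$ and $\triangle_X\subseteq E'\subseteq E$ then $E'\in\mathcal{E}$. A subfamily $\mathcal{E}'\subseteq\mathcal{E}$ is a base of $\mathcal{E}$ if each $E\in\mathcal{E}$ is contained in some $E'\in\mathcal{E}'$. The pair $(X,\mathcal{E})$ is called a ballean (coarse space). For $x\in X$, $Y\subseteq X$, $E\in\mathcal{E}$, put $E[x]=\{y\in X:(x,y)\in E\}$ and $E[Y]=\bigcup_{y\in Y}E[y]$. All balleans are connected: for any $x,y\in X$ there is $E\in\mathcal{E}$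 with $y\in E[x]$. A subset $Y\subseteq X$ is bounded if $Y\subseteq E[x]$ for some $E\in\mathcal{E}$, $x\in X$. **Normality.** A subset $U\subseteq X$ is an asymptotic neighbourhood of $Y\subseteq X$ if for every $E\in\mathcal{E}$ the set $E[Y]\setminus U$ is bounded. Subsets $Y,Z\subseteq X$ are asymptotically disjoint if $E[Y]\cap E[Z]$ is bounded for every $E\in\mathcal{E}$; they are asymptotically separated if they have disjoint asymptotic neighbourhoods. The ballean $(X,\mathcal{E})$ is normal if any two asymptotically disjoint subsets of $X$ are asymptotically separated. **The $\mathcal{B}$-macrocube.** For a bornology $\mathcal{B}$ on an infinite cardinal $\kappa$ with $\kappa\notin\mathcal{B}$, let $\{0,1\}^{\mathcal{B}}=\{(x_\alpha)_{\alpha<\kappa}\in\{0,1\}^\kappa:\{\alpha: x_\alpha=1\}\in\mathcal{B}\}$. The $\mathcal{B}$-macrocube is this set with the coarse structure having as a base the sets $\{(x,y)\in\{0,1\}^{\mathcal{B}}\times\{0,1\}^{\mathcal{B}}: x_\alpha=y_\alpha\text{ for all }\alpha\in\kappa\setminus B\}$, $B\in\mathcal{B}$. *)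

theory Defs
  imports Main "HOL-Library.FuncSet"
begin

definition bornology_on :: "'a set \<Rightarrow> 'a set set \<Rightarrow> bool" where
  "bornology_on X \<B> \<longleftrightarrow>
     \<B> \<subseteq> Pow X \<and>
     (\<forall>A. A \<subseteq> X \<longrightarrow> finite A \<longrightarrow> A \<in> \<B>) \<and>
     (\<forall>\<F>. \<F> \<subseteq> \<B> \<longrightarrow> finite \<F> \<longrightarrow> \<Union>\<F> \<in> \<B>) \<and>
     (\<forall>B\<in>\<B>. \<forall>A. A \<subseteq> B \<longrightarrow> A \<in> \<B>)"

text \<open>
  A base of a bornology and a base of a coarse structure are both cofinal subfamilies
  with respect to inclusion.
\<close>

definition base_of :: "'b set set \<Rightarrow> 'b set set \<Rightarrow> bool" where
  "base_of \<B>' \<B> \<longleftrightarrow> \<B>' \<subseteq> \<B> \<and> (\<forall>B\<in>\<B>. \<exists>B'\<in>\<B>'. B \<subseteq> B')"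

text \<open>
  Balls \<open>E[x]\<close> and \<open>E[Y]\<close> are the relational images \<open>E `` {x}\<close> and \<open>E `` Y\<close>.
\<close>

definition coarse_structure :: "'a set \<Rightarrow> 'a rel set \<Rightarrow> bool" where
  "coarse_structure X \<E> \<longleftrightarrow>
     \<E> \<subseteq> Pow (X \<times> X) \<and>
     (\<forall>E\<in>\<E>. Id_on X \<subseteq> E) \<and>
     (\<forall>E\<in>\<E>. \<forall>E'\<in>\<E>. E O E' \<in> \<E>) \<and>
     (\<forall>E\<in>\<E>. E\<inverse> \<in> \<E>) \<and>
     (\<forall>E\<in>\<E>. \<forall>E'. Id_on X \<subseteq> E' \<and> E' \<subseteq> E \<longrightarrow> E' \<in> \<E>)"

text \<open>Balleans are connected by convention.\<close>

definition ballean :: "'a set \<Rightarrow> 'a rel set \<Rightarrow> bool" where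
  "ballean X \<E> \<longleftrightarrow>
     coarse_structure X \<E> \<and> (\<forall>x\<in>X. \<forall>y\<in>X. \<exists>E\<in>\<E>. y \<in> E `` {x})"

definition coarse_bounded :: "'a set \<Rightarrow> 'a rel set \<Rightarrow> 'a set \<Rightarrow> bool" where
  "coarse_bounded X \<E> Y \<longleftrightarrow> Y \<subseteq> X \<and> (\<exists>E\<in>\<E>. \<exists>x\<in>X. Y \<subseteq> E `` {x})"

definition asymp_nbhd :: "'a set \<Rightarrow> 'a rel set \<Rightarrow> 'a set \<Rightarrow> 'a set \<Rightarrow> bool" where
  "asymp_nbhd X \<E> U Y \<longleftrightarrow> U \<subseteq> X \<and> (\<forall>E\<in>\<E>. coarse_bounded X \<E> (E `` Y - U))"

definition asymp_disjoint :: "'a set \<Rightarrow> 'a rel set \<Rightarrow> 'a set \<Rightarrow> 'a set \<Rightarrow> bool" where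
  "asymp_disjoint X \<E> Y Z \<longleftrightarrow> (\<forall>E\<in>\<E>. coarse_bounded X \<E> (E `` Y \<inter> E `` Z))"

definition asymp_separated :: "'a set \<Rightarrow> 'a rel set \<Rightarrow> 'a set \<Rightarrow> 'a set \<Rightarrow> bool" where
  "asymp_separated X \<E> Y Z \<longleftrightarrow>
     (\<exists>U V. asymp_nbhd X \<E> U Y \<and> asymp_nbhd X \<E> V Z \<and> U \<inter> V = {})"

definition normal_ballean :: "'a set \<Rightarrow> 'a rel set \<Rightarrow> bool" where
  "normal_ballean X \<E> \<longleftrightarrow>
     ballean X \<E> \<and>
     (\<forall>Y Z. Y \<subseteq> X \<and> Z \<subseteq> X \<and> asymp_disjoint X \<E> Y Z \<longrightarrow> asymp_separated X \<E> Y Z)"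

text \<open>
  A cardinal is represented by a cardinal order \<open>\<kappa>\<close>, the ordinals below it by the elements of
  \<open>Field \<kappa>\<close>.  Points of the macrocube take the value \<open>undefined\<close> outside \<open>Field \<kappa>\<close>, so that
  they correspond exactly to functions from \<open>Field \<kappa>\<close> to \<open>{0, 1}\<close>.
\<close>

definition macrocube :: "'a rel \<Rightarrow> 'a set set \<Rightarrow> ('a \<Rightarrow> nat) set" where
  "macrocube \<kappa> \<B> = {x \<in> Field \<kappa> \<rightarrow>\<^sub>E {0, 1}. {\<alpha> \<in> Field \<kappa>. x \<alpha> = 1} \<in> \<B>}"

definition macrocube_entourage :: "'a rel \<Rightarrow> 'a set set \<Rightarrow> 'a set \<Rightarrow> ('a \<Rightarrow> nat) rel" where
  "macrocube_entourage \<kappa> \<B> B =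
     {(x, y) \<in> macrocube \<kappa> \<B> \<times> macrocube \<kappa> \<B>. \<forall>\<alpha> \<in> Field \<kappa> - B. x \<alpha> = y \<alpha>}"

text \<open>
  The only coarse structure with a given base consists of all sets containing the diagonal
  and contained in a member of the base.
\<close>

definition macrocube_coarse :: "'a rel \<Rightarrow> 'a set set \<Rightarrow> ('a \<Rightarrow> nat) rel set" where
  "macrocube_coarse \<kappa> \<B> =
     {E. Id_on (macrocube \<kappa> \<B>) \<subseteq> E \<and> (\<exists>B\<in>\<B>. E \<subseteq> macrocube_entourage \<kappa> \<B> B)}"

lemma macrocube_coarse_base:
  "base_of (macrocube_entourage \<kappa> \<B> ` \<B>) (macrocube_coarse \<kappa> \<B>)"
proof -
  have "Id_on (macrocube \<kappa> \<B>) \<subseteq> macrocube_entourage \<kappa> \<B> B" for B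
    unfolding macrocube_entourage_def by auto
  then show ?thesis unfolding base_of_def macrocube_coarse_def by blast
qed

lemma macrocube_coarse_unique:
  assumes "coarse_structure (macrocube \<kappa> \<B>) \<E>"
    and "base_of (macrocube_entourage \<kappa> \<B> ` \<B>) \<E>"
  shows "\<E> = macrocube_coarse \<kappa> \<B>"
proof -
  have diag: "Id_on (macrocube \<kappa> \<B>) \<subseteq> E" if "E \<in> \<E>" for E
    using assms(1) that by (simp add: coarse_structure_def)
  have down: "E' \<in> \<E>" if "E \<in> \<E>" "Id_on (macrocube \<kappa> \<B>) \<subseteq> E'" "E' \<subseteq> E" for E E'
  proof -
    have "\<forall>E\<in>\<E>. \<forall>E'. Id_on (macrocube \<kappa> \<B>) \<subseteq> E' \<and> E' \<subseteq> E \<longrightarrow> E' \<in> \<E>"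
      using assms(1) unfolding coarse_structure_def by (elim conjE)
    from this[rule_format, OF that(1) conjI[OF that(2,3)]] show ?thesis .
  qed
  have base: "macrocube_entourage \<kappa> \<B> B \<in> \<E>" if "B \<in> \<B>" for B
    using assms(2) that by (simp add: base_of_def image_subset_iff)
  have cofinal: "\<exists>B\<in>\<B>. E \<subseteq> macrocube_entourage \<kappa> \<B> B" if "E \<in> \<E>" for E
    using assms(2) that by (simp add: base_of_def)
  show ?thesis
  proof (intro set_eqI iffI)
    fix E assume "E \<in> \<E>"
    with diag cofinal show "E \<in> macrocube_coarse \<kappa> \<B>"
      by (simp add: macrocube_coarse_def)
  next
    fix E assume "E \<in> macrocube_coarse \<kappa> \<B>"
    then obtain B where B: "Id_on (macrocube \<kappa> \<B>) \<subseteq> E" "B \<in> \<B>"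
        "E \<subseteq> macrocube_entourage \<kappa> \<B> B"
      unfolding macrocube_coarse_def by (elim CollectE conjE bexE)
    show "E \<in> \<E>" by (rule down[OF base[OF B(2)] B(1) B(3)])
  qed
qed

lemma bornology_on_Un:
  assumes "bornology_on X \<B>" "A \<in> \<B>" "B \<in> \<B>"
  shows "A \<union> B \<in> \<B>"
proof -
  have "{A, B} \<subseteq> \<B>" "finite {A, B}" using assms by auto
  then have "\<Union>{A, B} \<in> \<B>" using assms(1) unfolding bornology_on_def by blast
  then show ?thesis by simp
qed

lemma macrocube_entourage_iff:
  "(x, y) \<in> macrocube_entourage \<kappa> \<B> B \<longleftrightarrow>
     x \<in> macrocube \<kappa> \<B> \<and> y \<in> macrocube \<kappa> \<B> \<and> (\<forall>\<alpha> \<in> Field \<kappa> - B. x \<alpha> = y \<alpha>)"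
  unfolding macrocube_entourage_def by simp

lemma macrocube_coarseI:
  assumes "Id_on (macrocube \<kappa> \<B>) \<subseteq> E" "B \<in> \<B>" "E \<subseteq> macrocube_entourage \<kappa> \<B> B"
  shows "E \<in> macrocube_coarse \<kappa> \<B>"
  using assms unfolding macrocube_coarse_def by blast

lemma macrocube_coarseE:
  assumes "E \<in> macrocube_coarse \<kappa> \<B>"
  obtains B where "Id_on (macrocube \<kappa> \<B>) \<subseteq> E" "B \<in> \<B>" "E \<subseteq> macrocube_entourage \<kappa> \<B> B"
  using assms unfolding macrocube_coarse_def by blast

lemma macrocube_ballean:
  assumes "bornology_on (Field \<kappa>) \<B>"
  shows "ballean (macrocube \<kappa> \<B>) (macrocube_coarse \<kappa> \<B>)"
  unfolding ballean_def coarse_structure_def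
proof (intro conjI ballI allI impI subsetI)
  fix E assume "E \<in> macrocube_coarse \<kappa> \<B>"
  then obtain B where "E \<subseteq> macrocube_entourage \<kappa> \<B> B"
    by (rule macrocube_coarseE)
  then show "E \<in> Pow (macrocube \<kappa> \<B> \<times> macrocube \<kappa> \<B>)"
    unfolding macrocube_entourage_def by blast
next
  fix E p assume "E \<in> macrocube_coarse \<kappa> \<B>" "p \<in> Id_on (macrocube \<kappa> \<B>)"
  then show "p \<in> E"
    by (meson macrocube_coarseE subsetD)
next
  fix E E' assume E: "E \<in> macrocube_coarse \<kappa> \<B>" and E': "E' \<in> macrocube_coarse \<kappa> \<B>"
  from E obtain B where B: "Id_on (macrocube \<kappa> \<B>) \<subseteq> E" "B \<in> \<B>"
      "E \<subseteq> macrocube_entourage \<kappa> \<B> B"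
    by (rule macrocube_coarseE)
  from E' obtain B' where B': "Id_on (macrocube \<kappa> \<B>) \<subseteq> E'" "B' \<in> \<B>"
      "E' \<subseteq> macrocube_entourage \<kappa> \<B> B'"
    by (rule macrocube_coarseE)
  show "E O E' \<in> macrocube_coarse \<kappa> \<B>"
  proof (rule macrocube_coarseI)
    show "Id_on (macrocube \<kappa> \<B>) \<subseteq> E O E'"
      using B(1) B'(1) by (auto simp: Id_on_def)
    show "B \<union> B' \<in> \<B>"
      using bornology_on_Un assms B(2) B'(2) .
    show "E O E' \<subseteq> macrocube_entourage \<kappa> \<B> (B \<union> B')"
    proof (rule subrelI)
      fix x z assume "(x, z) \<in> E O E'"
      then obtain y where "(x, y) \<in> E" "(y, z) \<in> E'" by (rule relcompE) simp
      then have "(x, y) \<in> macrocube_entourage \<kappa> \<B> B" "(y, z) \<in> macrocube_entourage \<kappa> \<B> B'"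
        using B(3) B'(3) by (simp_all only: subsetD)
      then show "(x, z) \<in> macrocube_entourage \<kappa> \<B> (B \<union> B')"
        unfolding macrocube_entourage_iff by simp
    qed
  qed
next
  fix E assume "E \<in> macrocube_coarse \<kappa> \<B>"
  then obtain B where B: "Id_on (macrocube \<kappa> \<B>) \<subseteq> E" "B \<in> \<B>"
      "E \<subseteq> macrocube_entourage \<kappa> \<B> B"
    by (rule macrocube_coarseE)
  show "E\<inverse> \<in> macrocube_coarse \<kappa> \<B>"
  proof (rule macrocube_coarseI)
    show "Id_on (macrocube \<kappa> \<B>) \<subseteq> E\<inverse>"
      using B(1) by (auto simp: Id_on_def)
    show "B \<in> \<B>" by fact
    show "E\<inverse> \<subseteq> macrocube_entourage \<kappa> \<B> B"
    proof (rule subrelI)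
      fix x y assume "(x, y) \<in> E\<inverse>"
      then have "(y, x) \<in> macrocube_entourage \<kappa> \<B> B"
        using B(3) by blast
      then show "(x, y) \<in> macrocube_entourage \<kappa> \<B> B"
        unfolding macrocube_entourage_iff by simp
    qed
  qed
next
  fix E E'
  assume "E \<in> macrocube_coarse \<kappa> \<B>" and E': "Id_on (macrocube \<kappa> \<B>) \<subseteq> E' \<and> E' \<subseteq> E"
  then obtain B where "B \<in> \<B>" "E \<subseteq> macrocube_entourage \<kappa> \<B> B"
    by (meson macrocube_coarseE)
  with E' show "E' \<in> macrocube_coarse \<kappa> \<B>"
    by (meson macrocube_coarseI subset_trans)
next
  fix x y assume x: "x \<in> macrocube \<kappa> \<B>" and y: "y \<in> macrocube \<kappa> \<B>"
  define B where "B = {\<alpha> \<in> Field \<kappa>. x \<alpha> = 1} \<union> {\<alpha> \<in> Field \<kappa>. y \<alpha> = 1}"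
  have "{\<alpha> \<in> Field \<kappa>. x \<alpha> = 1} \<in> \<B>" "{\<alpha> \<in> Field \<kappa>. y \<alpha> = 1} \<in> \<B>"
    using x y unfolding macrocube_def by simp_all
  then have B: "B \<in> \<B>"
    unfolding B_def by (rule bornology_on_Un[OF assms])
  have "x \<alpha> = y \<alpha>" if "\<alpha> \<in> Field \<kappa> - B" for \<alpha>
  proof -
    have "x \<in> Field \<kappa> \<rightarrow>\<^sub>E {0, 1}" "y \<in> Field \<kappa> \<rightarrow>\<^sub>E {0, 1}"
      using x y unfolding macrocube_def by simp_all
    then have "x \<alpha> \<in> {0, 1}" "y \<alpha> \<in> {0, 1}"
      using that by (metis DiffD1 PiE_mem)+
    moreover have "x \<alpha> \<noteq> 1" "y \<alpha> \<noteq> 1"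
      using that unfolding B_def by simp_all
    ultimately show ?thesis by simp
  qed
  then have "(x, y) \<in> macrocube_entourage \<kappa> \<B> B"
    using x y unfolding macrocube_entourage_iff by simp
  moreover have "macrocube_entourage \<kappa> \<B> B \<in> macrocube_coarse \<kappa> \<B>"
    using macrocube_coarse_base B unfolding base_of_def by blast
  ultimately show "\<exists>E\<in>macrocube_coarse \<kappa> \<B>. y \<in> E `` {x}"
    by blast
qed

end

theory Submission
  imports Defs
begin

text \<open>
  A point of the macrocube is determined by its support, a member of \<open>\<B>\<close>; the \<open>B\<close>-ball around
  \<open>y\<close> consists of the \<open>x \<in> \<B>\<close> whose symmetric difference with \<open>y\<close> lies in \<open>B\<close>, and a family of
  supports is bounded iff all its members lie in a single member of \<open>\<B>\<close>.

  If \<open>\<B>\<close> has a linearly ordered base, so has the coarse structure, and any ballean of this kind is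
  normal (\<open>normal_ballean_chain_base\<close>): the points reached from \<open>Y\<close> by a basic entourage that does
  not yet reach them from \<open>Z\<close> form an asymptotic neighbourhood of \<open>Y\<close>, and for entourages from a
  chain no point can be reached earlier from both sides.

  Conversely, normality gives, for every two asymptotically disjoint families \<open>Y\<close> and \<open>Z\<close> of
  supports, a set \<open>U\<close> that contains the points at a given distance from \<open>Y\<close> and avoids those at a
  given distance from \<open>Z\<close>, up to bounded sets.  It is used twice.

  With \<open>Y\<close> an unbounded chain in \<open>\<B>\<close> and \<open>Z\<close> the family of all singletons, it yields a set
  \<open>P\<close> with \<open>P \<notin> \<B>\<close> and \<open>X - P \<notin> \<B>\<close>, where \<open>X\<close> is the underlying set (\<open>normal_splits\<close>).  For
  \<open>C\<close> in the chain choose a much larger member \<open>h C\<close>.  The point \<open>{a} \<union> (h C - C)\<close> with \<open>a \<in> C\<close>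
  agrees with \<open>h C\<close> outside \<open>C\<close> and is forced into \<open>U\<close>.  If the gaps \<open>h C - C\<close> at
  an unbounded set of \<open>C\<close> were contained in one member of \<open>\<B>\<close>, the same points would be close to the singletons
  \<open>{a}\<close> and forced out of \<open>U\<close>.  Thus the union of gaps over an unbounded part of the chain is
  never in \<open>\<B>\<close>, and taking alternate gaps in a sparse part gives two disjoint unions of this kind.

  With \<open>Y\<close> the singletons from \<open>P\<close> and \<open>Z\<close> those from \<open>Q = X - P\<close>, the set \<open>U\<close> restricted to
  pairs \<open>{p, q}\<close> is a relation between \<open>P\<close> and \<open>Q\<close> under which each bounded \<open>A \<subseteq> P\<close> has a bounded
  set \<open>g A\<close> of partners, and each bounded \<open>B \<subseteq> Q\<close> has a bounded set \<open>f B\<close> of elements of \<open>P\<close> that are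
  not partners of all of \<open>B\<close>.  Then \<open>A \<subseteq> f B\<close> whenever \<open>B\<close> is not contained in \<open>g A\<close>, which makes
  the sets \<open>g A\<close> so nearly linearly ordered that a maximal chain of them is cofinal
  (\<open>cofinal_chain_of_near_chain\<close>); adding to its members \<open>G\<close> the sets \<open>f G\<close> gives a base of \<open>\<B>\<close>
  (\<open>linear_base_of_relation\<close>).
\<close>

section \<open>Chains\<close>

lemma maximal_chain:
  obtains M where "M \<subseteq> A"
    and "\<And>x y. x \<in> M \<Longrightarrow> y \<in> M \<Longrightarrow> x = y \<or> R x y \<or> R y x"
    and "\<And>z. z \<in> A \<Longrightarrow> (\<And>x. x \<in> M \<Longrightarrow> R x z) \<Longrightarrow> z \<in> M"
proof -
  obtain M where M: "pred_on.maxchain A R M"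
    using pred_on.Hausdorff[of A R] by blast
  then have chain: "pred_on.chain A R M"
    by (simp add: pred_on.maxchain_def)
  show thesis
  proof (rule that)
    show "x = y \<or> R x y \<or> R y x" if "x \<in> M" "y \<in> M" for x y
      using chain that by (auto simp: pred_on.chain_def)
    show "M \<subseteq> A" using chain by (simp add: pred_on.chain_def)
    show "z \<in> M" if "z \<in> A" "\<And>x. x \<in> M \<Longrightarrow> R x z" for z
    proof (rule ccontr)
      assume "z \<notin> M"
      moreover have "pred_on.chain A R (insert z M)"
        using chain that unfolding pred_on.chain_def by (metis insert_iff insert_subset sup2CI)
      ultimately show False
        using M by (auto simp: pred_on.maxchain_def)
    qed
  qed
qed

text \<open>
  The hypothesis is a weak form of linearity: all members that do not contain \<open>G\<close> lie below one
  common member \<open>\<psi> G\<close>.  If no member of a maximal chain contained \<open>G\<close>, the whole chain would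
  lie below \<open>G \<union> \<psi> G\<close>, which by maximality would belong to the chain.
\<close>

lemma cofinal_chain_of_near_chain:
  assumes Un: "\<And>G H. G \<in> \<G> \<Longrightarrow> H \<in> \<G> \<Longrightarrow> G \<union> H \<in> \<G>"
    and closed: "\<And>G. G \<in> \<G> \<Longrightarrow> \<psi> G \<in> \<G>"
    and near: "\<And>G H. G \<in> \<G> \<Longrightarrow> H \<in> \<G> \<Longrightarrow> G \<subseteq> H \<or> H \<subseteq> \<psi> G"
  obtains \<L> where "\<L> \<subseteq> \<G>" "\<And>L M. L \<in> \<L> \<Longrightarrow> M \<in> \<L> \<Longrightarrow> L \<subseteq> M \<or> M \<subseteq> L"
    "\<And>G. G \<in> \<G> \<Longrightarrow> \<exists>L\<in>\<L>. G \<subseteq> L"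
proof -
  obtain \<L> where sub: "\<L> \<subseteq> \<G>"
    and chain: "\<And>L M. L \<in> \<L> \<Longrightarrow> M \<in> \<L> \<Longrightarrow> L = M \<or> L \<subseteq> M \<or> M \<subseteq> L"
    and max: "\<And>H. H \<in> \<G> \<Longrightarrow> (\<And>L. L \<in> \<L> \<Longrightarrow> L \<subseteq> H) \<Longrightarrow> H \<in> \<L>"
    using maximal_chain[of \<G> "(\<subseteq>)"] by blast
  have "\<exists>L\<in>\<L>. G \<subseteq> L" if G: "G \<in> \<G>" for G
  proof (rule ccontr)
    assume *: "\<not> (\<exists>L\<in>\<L>. G \<subseteq> L)"
    then have "L \<subseteq> G \<union> \<psi> G" if "L \<in> \<L>" for L
      using near[OF G] sub that by blast
    then have "G \<union> \<psi> G \<in> \<L>"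
      using max Un closed G by blast
    with * show False by blast
  qed
  then show thesis
    using that[OF sub] chain by blast
qed

section \<open>Balleans with a linearly ordered base are normal\<close>

lemma coarse_bounded_subset:
  "coarse_bounded X \<E> S \<Longrightarrow> T \<subseteq> S \<Longrightarrow> coarse_bounded X \<E> T"
  unfolding coarse_bounded_def by (meson subset_trans)

lemma normal_ballean_chain_base:
  assumes ballean: "ballean X \<E>" and base: "base_of \<E>' \<E>"
    and chain: "\<And>E E'. E \<in> \<E>' \<Longrightarrow> E' \<in> \<E>' \<Longrightarrow> E \<subseteq> E' \<or> E' \<subseteq> E"
  shows "normal_ballean X \<E>"
  unfolding normal_ballean_def
proof (intro conjI allI impI)
  show "ballean X \<E>" by fact
next
  fix Y Z assume YZ: "Y \<subseteq> X \<and> Z \<subseteq> X \<and> asymp_disjoint X \<E> Y Z"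
  define closer where "closer S T = {x \<in> X. \<exists>E\<in>\<E>'. x \<in> E `` S \<and> x \<notin> E `` T}" for S T
  have nbhd: "asymp_nbhd X \<E> (closer S T) S" if disj: "asymp_disjoint X \<E> S T" for S T
    unfolding asymp_nbhd_def
  proof (intro conjI ballI)
    show "closer S T \<subseteq> X" by (auto simp: closer_def)
  next
    fix E assume E: "E \<in> \<E>"
    then obtain E' where E': "E' \<in> \<E>'" "E \<subseteq> E'"
      using base by (auto simp: base_of_def)
    then have E'E: "E' \<in> \<E>"
      using base by (auto simp: base_of_def)
    have "E \<subseteq> X \<times> X"
      using ballean E by (auto simp: ballean_def coarse_structure_def)
    then have "E `` S - closer S T \<subseteq> E' `` S \<inter> E' `` T"
      using E' by (auto simp: closer_def)
    moreover have "coarse_bounded X \<E> (E' `` S \<inter> E' `` T)"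
      using disj E'E by (auto simp: asymp_disjoint_def)
    ultimately show "coarse_bounded X \<E> (E `` S - closer S T)"
      by (rule coarse_bounded_subset[rotated])
  qed
  have "asymp_disjoint X \<E> Z Y"
    using YZ by (simp add: asymp_disjoint_def Int_commute)
  moreover have "closer Y Z \<inter> closer Z Y = {}"
    using chain unfolding closer_def by blast
  ultimately show "asymp_separated X \<E> Y Z"
    using nbhd YZ unfolding asymp_separated_def by blast
qed

lemma macrocube_entourage_mono:
  "A \<subseteq> B \<Longrightarrow> macrocube_entourage \<kappa> \<B> A \<subseteq> macrocube_entourage \<kappa> \<B> B"
  by (rule subrelI) (auto simp only: macrocube_entourage_iff)

lemma normal_macrocube_of_linear_base:
  assumes born: "bornology_on (Field \<kappa>) \<B>" and base: "base_of \<L> \<B>"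
    and chain: "\<forall>A\<in>\<L>. \<forall>B\<in>\<L>. A \<subseteq> B \<or> B \<subseteq> A"
  shows "normal_ballean (macrocube \<kappa> \<B>) (macrocube_coarse \<kappa> \<B>)"
proof (rule normal_ballean_chain_base)
  show "ballean (macrocube \<kappa> \<B>) (macrocube_coarse \<kappa> \<B>)"
    using born by (rule macrocube_ballean)
  have "\<exists>L\<in>\<L>. E \<subseteq> macrocube_entourage \<kappa> \<B> L" if E: "E \<in> macrocube_coarse \<kappa> \<B>" for E
  proof -
    obtain B where "B \<in> \<B>" and EB: "E \<subseteq> macrocube_entourage \<kappa> \<B> B"
      using E by (rule macrocube_coarseE)
    then obtain L where "L \<in> \<L>" "B \<subseteq> L"
      using base by (auto simp: base_of_def)
    with EB show ?thesis
      using macrocube_entourage_mono by blast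
  qed
  moreover have "macrocube_entourage \<kappa> \<B> ` \<L> \<subseteq> macrocube_coarse \<kappa> \<B>"
    using base macrocube_coarse_base[of \<kappa> \<B>] unfolding base_of_def by blast
  ultimately show "base_of (macrocube_entourage \<kappa> \<B> ` \<L>) (macrocube_coarse \<kappa> \<B>)"
    by (auto simp: base_of_def)
  show "E \<subseteq> E' \<or> E' \<subseteq> E"
    if "E \<in> macrocube_entourage \<kappa> \<B> ` \<L>" "E' \<in> macrocube_entourage \<kappa> \<B> ` \<L>" for E E'
    using that chain macrocube_entourage_mono by (metis imageE)
qed

section \<open>Normality in terms of supports\<close>

text \<open>
  These are asymptotic disjointness and asymptotic neighbourhoods, transported to the ballean on
  \<open>\<B>\<close> whose balls are \<open>{x \<in> \<B>. sym_diff x y \<subseteq> B}\<close>.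
\<close>

definition far :: "'a set set \<Rightarrow> 'a set set \<Rightarrow> 'a set set \<Rightarrow> bool" where
  "far \<B> Y Z \<longleftrightarrow> (\<forall>B\<in>\<B>. \<exists>C\<in>\<B>. \<forall>y\<in>Y. \<forall>z\<in>Z. sym_diff y z \<subseteq> B \<longrightarrow> y \<union> z \<subseteq> C)"

definition surrounds :: "'a set set \<Rightarrow> 'a set set \<Rightarrow> 'a set set \<Rightarrow> bool" where
  "surrounds \<B> U Y \<longleftrightarrow> (\<forall>B\<in>\<B>. \<exists>C\<in>\<B>. \<forall>y\<in>Y. \<forall>x\<in>\<B>. sym_diff x y \<subseteq> B \<longrightarrow> x \<in> U \<or> x \<subseteq> C)"

lemma surroundsE:
  assumes "surrounds \<B> U Y" "B \<in> \<B>"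
  obtains C where "C \<in> \<B>"
    "\<And>y x. y \<in> Y \<Longrightarrow> x \<in> \<B> \<Longrightarrow> sym_diff x y \<subseteq> B \<Longrightarrow> x \<in> U \<or> x \<subseteq> C"
  using assms unfolding surrounds_def by meson

lemma surrounds_mono: "surrounds \<B> U Y \<Longrightarrow> U \<subseteq> V \<Longrightarrow> surrounds \<B> V Y"
  unfolding surrounds_def by (meson subsetD)

definition normal_family :: "'a set set \<Rightarrow> bool" where
  "normal_family \<B> \<longleftrightarrow>
     (\<forall>Y Z. Y \<subseteq> \<B> \<and> Z \<subseteq> \<B> \<and> far \<B> Y Z \<longrightarrow> (\<exists>U. surrounds \<B> U Y \<and> surrounds \<B> (- U) Z))"

definition cube_point :: "'a rel \<Rightarrow> 'a set \<Rightarrow> 'a \<Rightarrow> nat" where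
  "cube_point \<kappa> A = (\<lambda>\<alpha>\<in>Field \<kappa>. if \<alpha> \<in> A then 1 else 0)"

lemma bornology_on_subset: "bornology_on X \<B> \<Longrightarrow> B \<in> \<B> \<Longrightarrow> A \<subseteq> B \<Longrightarrow> A \<in> \<B>"
  unfolding bornology_on_def by meson

lemma bornology_on_carrier: "bornology_on X \<B> \<Longrightarrow> B \<in> \<B> \<Longrightarrow> B \<subseteq> X"
  by (auto simp: bornology_on_def)

lemma bornology_on_finite: "bornology_on X \<B> \<Longrightarrow> A \<subseteq> X \<Longrightarrow> finite A \<Longrightarrow> A \<in> \<B>"
  by (simp add: bornology_on_def)

lemma support_cube_point: "A \<subseteq> Field \<kappa> \<Longrightarrow> {\<alpha> \<in> Field \<kappa>. cube_point \<kappa> A \<alpha> = 1} = A"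
  by (auto simp: cube_point_def)

lemma cube_point_in_macrocube:
  assumes "bornology_on (Field \<kappa>) \<B>" "A \<in> \<B>"
  shows "cube_point \<kappa> A \<in> macrocube \<kappa> \<B>"
proof -
  have "cube_point \<kappa> A \<in> Field \<kappa> \<rightarrow>\<^sub>E {0, 1}"
    by (simp add: cube_point_def)
  then show ?thesis
    using assms(2) support_cube_point[OF bornology_on_carrier[OF assms]]
    by (simp add: macrocube_def)
qed

lemma macrocube_point:
  assumes "x \<in> macrocube \<kappa> \<B>"
  obtains A where "A \<in> \<B>" "x = cube_point \<kappa> A"
proof (rule that)
  show "{\<alpha> \<in> Field \<kappa>. x \<alpha> = 1} \<in> \<B>"
    using assms by (simp add: macrocube_def)
  have x: "x \<in> Field \<kappa> \<rightarrow>\<^sub>E {0, 1}"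
    using assms by (simp add: macrocube_def)
  show "x = cube_point \<kappa> {\<alpha> \<in> Field \<kappa>. x \<alpha> = 1}"
  proof
    fix \<alpha> show "x \<alpha> = cube_point \<kappa> {\<alpha> \<in> Field \<kappa>. x \<alpha> = 1} \<alpha>"
    proof (cases "\<alpha> \<in> Field \<kappa>")
      case True
      then have "x \<alpha> = 0 \<or> x \<alpha> = 1" using PiE_mem[OF x] by blast
      with True show ?thesis by (auto simp: cube_point_def)
    next
      case False
      then show ?thesis using PiE_arb[OF x] by (simp add: cube_point_def)
    qed
  qed
qed

lemma cube_point_entourage:
  assumes "bornology_on (Field \<kappa>) \<B>" "x \<in> \<B>" "y \<in> \<B>"
  shows "(cube_point \<kappa> x, cube_point \<kappa> y) \<in> macrocube_entourage \<kappa> \<B> B \<longleftrightarrow> sym_diff x y \<subseteq> B"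
proof -
  have "cube_point \<kappa> x \<alpha> = cube_point \<kappa> y \<alpha> \<longleftrightarrow> (\<alpha> \<in> x \<longleftrightarrow> \<alpha> \<in> y)" if "\<alpha> \<in> Field \<kappa>" for \<alpha>
    using that by (simp add: cube_point_def)
  then have "(\<forall>\<alpha>\<in>Field \<kappa> - B. cube_point \<kappa> x \<alpha> = cube_point \<kappa> y \<alpha>) \<longleftrightarrow>
      (\<forall>\<alpha>\<in>Field \<kappa> - B. \<alpha> \<in> x \<longleftrightarrow> \<alpha> \<in> y)"
    by (intro ball_cong) simp_all
  then show ?thesis
    by (simp add: macrocube_entourage_iff cube_point_in_macrocube[OF assms(1)] assms(2,3))
      (use assms(2,3)[THEN bornology_on_carrier[OF assms(1)]] in blast)
qed

lemma coarse_bounded_cube_points: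
  assumes born: "bornology_on (Field \<kappa>) \<B>" and S: "S \<subseteq> \<B>"
  shows "coarse_bounded (macrocube \<kappa> \<B>) (macrocube_coarse \<kappa> \<B>) (cube_point \<kappa> ` S) \<longleftrightarrow>
    (\<exists>C\<in>\<B>. \<forall>x\<in>S. x \<subseteq> C)"
proof
  assume "coarse_bounded (macrocube \<kappa> \<B>) (macrocube_coarse \<kappa> \<B>) (cube_point \<kappa> ` S)"
  then obtain E w where E: "E \<in> macrocube_coarse \<kappa> \<B>" and w: "w \<in> macrocube \<kappa> \<B>"
    and S_E: "cube_point \<kappa> ` S \<subseteq> E `` {w}"
    by (auto simp: coarse_bounded_def)
  obtain B where B: "B \<in> \<B>" "E \<subseteq> macrocube_entourage \<kappa> \<B> B"
    using E by (rule macrocube_coarseE)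
  obtain A where A: "A \<in> \<B>" "w = cube_point \<kappa> A"
    using w by (rule macrocube_point)
  have "x \<subseteq> A \<union> B" if "x \<in> S" for x
  proof -
    have "(cube_point \<kappa> A, cube_point \<kappa> x) \<in> macrocube_entourage \<kappa> \<B> B"
      using that S_E A B by blast
    then have "sym_diff A x \<subseteq> B"
      using cube_point_entourage[OF born A(1)] S that by blast
    then show ?thesis by blast
  qed
  then show "\<exists>C\<in>\<B>. \<forall>x\<in>S. x \<subseteq> C"
    using bornology_on_Un[OF born A(1) B(1)] by blast
next
  assume "\<exists>C\<in>\<B>. \<forall>x\<in>S. x \<subseteq> C"
  then obtain C where C: "C \<in> \<B>" "\<forall>x\<in>S. x \<subseteq> C" by blast
  have empty: "{} \<in> \<B>"
    using bornology_on_finite[OF born] by blast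
  have "cube_point \<kappa> ` S \<subseteq> macrocube_entourage \<kappa> \<B> C `` {cube_point \<kappa> {}}"
    using C(2) S cube_point_entourage[OF born empty] by blast
  moreover have "macrocube_entourage \<kappa> \<B> C \<in> macrocube_coarse \<kappa> \<B>"
    using macrocube_coarse_base C(1) unfolding base_of_def by blast
  moreover have "cube_point \<kappa> ` S \<subseteq> macrocube \<kappa> \<B>"
    using S cube_point_in_macrocube[OF born] by blast
  ultimately show "coarse_bounded (macrocube \<kappa> \<B>) (macrocube_coarse \<kappa> \<B>) (cube_point \<kappa> ` S)"
    using cube_point_in_macrocube[OF born empty] unfolding coarse_bounded_def by blast
qed

lemma normal_family_of_normal_macrocube:
  assumes born: "bornology_on (Field \<kappa>) \<B>"
    and normal: "normal_ballean (macrocube \<kappa> \<B>) (macrocube_coarse \<kappa> \<B>)"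
  shows "normal_family \<B>"
  unfolding normal_family_def
proof (intro allI impI)
  let ?X = "macrocube \<kappa> \<B>" and ?\<E> = "macrocube_coarse \<kappa> \<B>" and ?p = "cube_point \<kappa>"
  fix Y Z assume "Y \<subseteq> \<B> \<and> Z \<subseteq> \<B> \<and> far \<B> Y Z"
  then have Y: "Y \<subseteq> \<B>" and Z: "Z \<subseteq> \<B>" and far: "far \<B> Y Z" by auto
  have "asymp_disjoint ?X ?\<E> (?p ` Y) (?p ` Z)"
    unfolding asymp_disjoint_def
  proof
    fix E assume E: "E \<in> ?\<E>"
    obtain B where B: "B \<in> \<B>" "E \<subseteq> macrocube_entourage \<kappa> \<B> B"
      using E by (rule macrocube_coarseE)
    obtain C where C: "C \<in> \<B>" "\<forall>y\<in>Y. \<forall>z\<in>Z. sym_diff y z \<subseteq> B \<longrightarrow> y \<union> z \<subseteq> C"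
      using far B(1) by (auto simp: far_def)
    define S where "S = {x \<in> \<B>. ?p x \<in> E `` ?p ` Y \<inter> E `` ?p ` Z}"
    have "w \<in> ?p ` S" if w: "w \<in> E `` ?p ` Y \<inter> E `` ?p ` Z" for w
    proof -
      have "w \<in> ?X"
        using w B(2) by (auto simp: macrocube_entourage_def)
      then show ?thesis
        using w by (elim macrocube_point) (auto simp: S_def)
    qed
    then have "E `` ?p ` Y \<inter> E `` ?p ` Z \<subseteq> ?p ` S"
      by (rule subsetI)
    then have "E `` ?p ` Y \<inter> E `` ?p ` Z = ?p ` S"
      unfolding S_def by (intro equalityI image_subsetI) (simp_all only: mem_Collect_eq)
    moreover have S: "S \<subseteq> \<B>"
      by (auto simp: S_def)
    moreover have "x \<subseteq> B \<union> C" if xS: "x \<in> S" for x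
    proof -
      have x: "x \<in> \<B>" using xS by (simp add: S_def)
      obtain y z where yz: "y \<in> Y" "z \<in> Z" "(?p y, ?p x) \<in> E" "(?p z, ?p x) \<in> E"
        using xS unfolding S_def by blast
      then have "sym_diff y x \<subseteq> B" "sym_diff z x \<subseteq> B"
        using cube_point_entourage[OF born _ x] B(2) Y Z by blast+
      moreover from this have "sym_diff y z \<subseteq> B" by blast
      ultimately show ?thesis using C(2) yz(1,2) by blast
    qed
    moreover have "B \<union> C \<in> \<B>"
      using bornology_on_Un[OF born B(1) C(1)] .
    ultimately show "coarse_bounded ?X ?\<E> (E `` ?p ` Y \<inter> E `` ?p ` Z)"
      using coarse_bounded_cube_points[OF born S] by metis
  qed
  moreover have "?p ` Y \<subseteq> ?X" "?p ` Z \<subseteq> ?X"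
    using Y Z cube_point_in_macrocube[OF born] by blast+
  ultimately have "asymp_separated ?X ?\<E> (?p ` Y) (?p ` Z)"
    using normal by (simp add: normal_ballean_def)
  then obtain U V where U: "asymp_nbhd ?X ?\<E> U (?p ` Y)" and V: "asymp_nbhd ?X ?\<E> V (?p ` Z)"
    and UV: "U \<inter> V = {}"
    by (auto simp: asymp_separated_def)
  have *: "surrounds \<B> {x. ?p x \<in> W} S"
    if W: "asymp_nbhd ?X ?\<E> W (?p ` S)" and S: "S \<subseteq> \<B>" for W S
    unfolding surrounds_def
  proof
    fix B assume B: "B \<in> \<B>"
    let ?E = "macrocube_entourage \<kappa> \<B> B"
    let ?T = "{x \<in> \<B>. ?p x \<in> ?E `` ?p ` S - W}"
    have "?E \<in> ?\<E>"
      using macrocube_coarse_base B unfolding base_of_def by blast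
    then have "coarse_bounded ?X ?\<E> (?E `` ?p ` S - W)"
      using W by (simp add: asymp_nbhd_def)
    moreover have "?p ` ?T \<subseteq> ?E `` ?p ` S - W" by auto
    ultimately have "coarse_bounded ?X ?\<E> (?p ` ?T)"
      by (rule coarse_bounded_subset)
    moreover have "?T \<subseteq> \<B>" by auto
    ultimately obtain C where C: "C \<in> \<B>" "\<forall>x\<in>?T. x \<subseteq> C"
      using coarse_bounded_cube_points[OF born] by metis
    have "x \<in> {x. ?p x \<in> W} \<or> x \<subseteq> C" if "y \<in> S" "x \<in> \<B>" "sym_diff x y \<subseteq> B" for x y
    proof -
      have "(?p y, ?p x) \<in> ?E"
        using cube_point_entourage[OF born, of y x B] that S by blast
      then show ?thesis using C(2) that by blast
    qed
    with C(1) show "\<exists>C\<in>\<B>. \<forall>y\<in>S. \<forall>x\<in>\<B>. sym_diff x y \<subseteq> B \<longrightarrow> x \<in> {x. ?p x \<in> W} \<or> x \<subseteq> C"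
      by blast
  qed
  have "surrounds \<B> (- {x. ?p x \<in> U}) Z"
    by (rule surrounds_mono[OF *[OF V Z]]) (use UV in auto)
  with *[OF U Y] show "\<exists>U. surrounds \<B> U Y \<and> surrounds \<B> (- U) Z"
    by (intro exI conjI)
qed

section \<open>A normal macrocube has two complementary unbounded sets of coordinates\<close>

text \<open>
  A set whose difference from a singleton lies in \<open>B\<close> has at most one element outside \<open>B\<close>.  If all
  members of the chain had at most one element outside \<open>B\<close>, this element would be the same for all
  of them, and the chain would be bounded.
\<close>

lemma far_chain_singletons:
  assumes born: "bornology_on X \<B>" and sub: "\<C> \<subseteq> \<B>"
    and chain: "\<And>C D. C \<in> \<C> \<Longrightarrow> D \<in> \<C> \<Longrightarrow> C \<subseteq> D \<or> D \<subseteq> C"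
    and unb: "\<And>M. M \<in> \<B> \<Longrightarrow> \<exists>C\<in>\<C>. \<not> C \<subseteq> M"
  shows "far \<B> \<C> ((\<lambda>a. {a}) ` X)"
  unfolding far_def
proof
  fix B assume B: "B \<in> \<B>"
  \<comment> \<open>A member with two elements outside \<open>B\<close> bounds all members close to a singleton.\<close>
  have "\<exists>C\<in>\<C>. \<forall>a. \<not> C \<subseteq> insert a B"
  proof (rule ccontr)
    assume "\<not> ?thesis"
    then have small: "\<exists>a. C \<subseteq> insert a B" if "C \<in> \<C>" for C
      using that by blast
    obtain C where C: "C \<in> \<C>" "\<not> C \<subseteq> B" using unb B by blast
    then obtain c where c: "c \<in> C" "c \<notin> B" by blast
    then have "{c} \<in> \<B>"
      using C(1) sub bornology_on_subset[OF born] by blast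
    then have "{c} \<union> B \<in> \<B>"
      using bornology_on_Un[OF born] B by blast
    then obtain D where D: "D \<in> \<C>" "\<not> D \<subseteq> {c} \<union> B" using unb by blast
    then obtain d where d: "d \<in> D" "d \<noteq> c" "d \<notin> B" by blast
    obtain a where "C \<union> D \<subseteq> insert a B"
      using small C(1) D(1) chain[OF C(1) D(1)] by (metis sup.absorb1 sup.absorb2)
    with c d show False by blast
  qed
  then obtain C where C: "C \<in> \<C>" "\<And>a. \<not> C \<subseteq> insert a B" by blast
  have "D \<union> {a} \<subseteq> B \<union> C" if D: "D \<in> \<C>" and diff: "sym_diff D {a} \<subseteq> B" for D a
  proof -
    have "D \<subseteq> insert a B" using diff by blast
    then have "D \<subseteq> C" using chain[OF D C(1)] C(2) by blast
    with diff show ?thesis by blast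
  qed
  moreover have "B \<union> C \<in> \<B>"
    using bornology_on_Un[OF born B] C(1) sub by blast
  ultimately show "\<exists>C\<in>\<B>. \<forall>y\<in>\<C>. \<forall>z\<in>(\<lambda>a. {a}) ` X. sym_diff y z \<subseteq> B \<longrightarrow> y \<union> z \<subseteq> C"
    by blast
qed

lemma unbounded_chain:
  assumes born: "bornology_on X \<B>" and X: "X \<notin> \<B>"
  obtains \<C> where "\<C> \<subseteq> \<B>" "\<And>C D. C \<in> \<C> \<Longrightarrow> D \<in> \<C> \<Longrightarrow> C \<subseteq> D \<or> D \<subseteq> C"
    "\<And>M. M \<in> \<B> \<Longrightarrow> \<exists>C\<in>\<C>. \<not> C \<subseteq> M"
proof -
  obtain \<C> where sub: "\<C> \<subseteq> \<B>"
    and chain: "\<And>C D. C \<in> \<C> \<Longrightarrow> D \<in> \<C> \<Longrightarrow> C = D \<or> C \<subseteq> D \<or> D \<subseteq> C"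
    and max: "\<And>M. M \<in> \<B> \<Longrightarrow> (\<And>C. C \<in> \<C> \<Longrightarrow> C \<subseteq> M) \<Longrightarrow> M \<in> \<C>"
    using maximal_chain[of \<B> "(\<subseteq>)"] by blast
  have "\<exists>C\<in>\<C>. \<not> C \<subseteq> M" if M: "M \<in> \<B>" for M
  proof (rule ccontr)
    assume *: "\<not> ?thesis"
    obtain a where a: "a \<in> X" "a \<notin> M"
      using X M bornology_on_carrier[OF born M] by (metis subsetI subset_antisym)
    have "{a} \<in> \<B>"
      using bornology_on_finite[OF born] a(1) by blast
    then have "{a} \<union> M \<in> \<B>"
      using bornology_on_Un[OF born] M by blast
    then have "{a} \<union> M \<in> \<C>"
      using * by (intro max) auto
    with * a show False by blast
  qed
  then show thesis
    using that[OF sub] chain by blast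
qed

text \<open>
  A maximal subfamily in which of two distinct members one contains the \<open>h\<close>-image of the other takes
  the place of a transfinite iteration of \<open>h\<close>.  If it were bounded, it could be extended by \<open>h T\<close>
  when it has a largest member \<open>T\<close>, and by any sufficiently large member of \<open>\<C>\<close> otherwise.
\<close>

lemma sparse_unbounded_subchain:
  assumes sub: "\<C> \<subseteq> \<B>"
    and chain: "\<And>C D. C \<in> \<C> \<Longrightarrow> D \<in> \<C> \<Longrightarrow> C \<subseteq> D \<or> D \<subseteq> C"
    and unb: "\<And>M. M \<in> \<B> \<Longrightarrow> \<exists>C\<in>\<C>. \<not> C \<subseteq> M"
    and h: "\<And>C. C \<in> \<C> \<Longrightarrow> h C \<in> \<C> \<and> C \<subset> h C"
  obtains \<I> where "\<I> \<subseteq> \<C>"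
    "\<And>C D. C \<in> \<I> \<Longrightarrow> D \<in> \<I> \<Longrightarrow> C = D \<or> h C \<subseteq> D \<or> h D \<subseteq> C"
    "\<And>M. M \<in> \<B> \<Longrightarrow> \<exists>C\<in>\<I>. \<not> C \<subseteq> M"
proof -
  obtain \<I> where I: "\<I> \<subseteq> \<C>"
    and sparse: "\<And>C D. C \<in> \<I> \<Longrightarrow> D \<in> \<I> \<Longrightarrow> C = D \<or> h C \<subseteq> D \<or> h D \<subseteq> C"
    and max: "\<And>D. D \<in> \<C> \<Longrightarrow> (\<And>C. C \<in> \<I> \<Longrightarrow> h C \<subseteq> D) \<Longrightarrow> D \<in> \<I>"
    using maximal_chain[of \<C> "\<lambda>C D. h C \<subseteq> D"] by blast
  have "\<exists>C\<in>\<I>. \<not> C \<subseteq> M" if M: "M \<in> \<B>" for M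
  proof (rule ccontr)
    assume *: "\<not> ?thesis"
    obtain D where D: "D \<in> \<C>" "\<not> D \<subseteq> M" using unb M by blast
    have below: "C \<subseteq> D" if "C \<in> \<I>" for C
      using that * D chain[of C D] I by blast
    show False
    proof (cases "\<exists>T\<in>\<I>. \<forall>C\<in>\<I>. C \<subseteq> T")
      case True
      then obtain T where T: "T \<in> \<I>" "\<And>C. C \<in> \<I> \<Longrightarrow> C \<subseteq> T" by blast
      have hT: "h T \<in> \<C>" "T \<subset> h T" using h I T(1) by blast+
      have "h C \<subseteq> h T" if "C \<in> \<I>" for C
        using sparse[OF that T(1)] T(2)[OF that] h[of T] I T(1) hT(2) by blast
      then have "h T \<in> \<I>" using max hT(1) by blast
      with T(2) hT(2) show False by blast
    next
      case False
      have "h C \<subseteq> D" if C: "C \<in> \<I>" for C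
      proof -
        obtain C' where C': "C' \<in> \<I>" "\<not> C' \<subseteq> C" using False C by blast
        then have "h C \<subseteq> C'"
          using sparse[OF C C'(1)] h[of C'] I by blast
        then show ?thesis using below C'(1) by blast
      qed
      then have "D \<in> \<I>" using max D(1) by blast
      with * D(2) show False by blast
    qed
  qed
  then show thesis
    using that[OF I sparse] by blast
qed

lemma normal_splits:
  assumes born: "bornology_on X \<B>" and X: "X \<notin> \<B>" and normal: "normal_family \<B>"
  obtains P where "P \<subseteq> X" "P \<notin> \<B>" "X - P \<notin> \<B>"
proof -
  obtain \<C> where sub: "\<C> \<subseteq> \<B>"
    and chain: "\<And>C D. C \<in> \<C> \<Longrightarrow> D \<in> \<C> \<Longrightarrow> C \<subseteq> D \<or> D \<subseteq> C"
    and unb: "\<And>M. M \<in> \<B> \<Longrightarrow> \<exists>C\<in>\<C>. \<not> C \<subseteq> M"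
    using unbounded_chain[OF born X] by blast
  have single: "{a} \<in> \<B>" if "a \<in> X" for a
    using bornology_on_finite[OF born] that by blast
  have "far \<B> \<C> ((\<lambda>a. {a}) ` X)"
    using far_chain_singletons[OF born sub chain unb] .
  moreover have "(\<lambda>a. {a}) ` X \<subseteq> \<B>" using single by blast
  ultimately obtain U where UC: "surrounds \<B> U \<C>" and UX: "surrounds \<B> (- U) ((\<lambda>a. {a}) ` X)"
    using normal sub unfolding normal_family_def by blast
  obtain F where F: "\<And>B. B \<in> \<B> \<Longrightarrow> F B \<in> \<B>"
    "\<And>B y x. B \<in> \<B> \<Longrightarrow> y \<in> \<C> \<Longrightarrow> x \<in> \<B> \<Longrightarrow> sym_diff x y \<subseteq> B \<Longrightarrow> x \<in> U \<or> x \<subseteq> F B"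
    using UC unfolding surrounds_def by metis
  have "\<exists>D\<in>\<C>. C \<subset> D \<and> \<not> D - C \<subseteq> F C" if C: "C \<in> \<C>" for C
  proof -
    have "C \<union> F C \<in> \<B>"
      using bornology_on_Un[OF born] F(1) C sub by blast
    then obtain D where D: "D \<in> \<C>" "\<not> D \<subseteq> C \<union> F C" using unb by blast
    then show ?thesis using chain[OF C D(1)] by blast
  qed
  then obtain h where h: "\<And>C. C \<in> \<C> \<Longrightarrow> h C \<in> \<C> \<and> C \<subset> h C \<and> \<not> h C - C \<subseteq> F C"
    by metis
  have gaps: "(\<Union>C\<in>\<I>. h C - C) \<notin> \<B>"
    if I: "\<I> \<subseteq> \<C>" and I_unb: "\<And>M. M \<in> \<B> \<Longrightarrow> \<exists>C\<in>\<I>. \<not> C \<subseteq> M" for \<I>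
  proof
    assume G: "(\<Union>C\<in>\<I>. h C - C) \<in> \<B>"
    obtain M where M: "M \<in> \<B>"
      "\<And>y x. y \<in> (\<lambda>a. {a}) ` X \<Longrightarrow> x \<in> \<B> \<Longrightarrow> sym_diff x y \<subseteq> (\<Union>C\<in>\<I>. h C - C) \<Longrightarrow>
        x \<in> - U \<or> x \<subseteq> M"
      using surroundsE[OF UX G] by blast
    obtain C a where Ca: "C \<in> \<I>" "a \<in> C" "a \<notin> M" using I_unb M(1) by blast
    have C: "C \<in> \<C>" "C \<in> \<B>" using Ca(1) I sub by blast+
    have a: "a \<in> X" using bornology_on_carrier[OF born C(2)] Ca(2) by blast
    \<comment> \<open>Close to \<open>h C\<close> and to \<open>{a}\<close> at once, but too large to be exempt for either.\<close>
    let ?x = "insert a (h C - C)"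
    have "?x \<subseteq> h C" using h[OF C(1)] Ca(2) by blast
    then have x: "?x \<in> \<B>"
      using bornology_on_subset[OF born] h[OF C(1)] sub by blast
    have "sym_diff ?x (h C) \<subseteq> C" using h[OF C(1)] Ca(2) by blast
    moreover have "h C \<in> \<C>" "\<not> ?x \<subseteq> F C" using h[OF C(1)] by blast+
    ultimately have "?x \<in> U" using F(2)[OF C(2) _ x] by blast
    moreover have "sym_diff ?x {a} \<subseteq> (\<Union>C\<in>\<I>. h C - C)" using Ca(1) by blast
    then have "?x \<notin> U \<or> ?x \<subseteq> M" using M(2)[OF imageI[OF a] x] by blast
    ultimately show False using Ca(3) by blast
  qed
  \<comment> \<open>Spacing by two steps of \<open>h\<close> leaves room for two disjoint gaps at each \<open>C\<close>.\<close>
  have hh: "h (h C) \<in> \<C> \<and> C \<subset> h (h C)" if "C \<in> \<C>" for C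
    using h[OF that] h[of "h C"] by blast
  obtain \<I> where I: "\<I> \<subseteq> \<C>"
    and sparse: "\<And>C D. C \<in> \<I> \<Longrightarrow> D \<in> \<I> \<Longrightarrow> C = D \<or> h (h C) \<subseteq> D \<or> h (h D) \<subseteq> C"
    and I_unb: "\<And>M. M \<in> \<B> \<Longrightarrow> \<exists>C\<in>\<I>. \<not> C \<subseteq> M"
    using sparse_unbounded_subchain[OF sub chain unb hh] by blast
  let ?P = "\<Union>C\<in>\<I>. h C - C" and ?Q = "\<Union>C\<in>h ` \<I>. h C - C"
  have P: "?P \<notin> \<B>" using gaps[OF I I_unb] .
  have hI: "h ` \<I> \<subseteq> \<C>" using h I by blast
  have "\<exists>C\<in>h ` \<I>. \<not> C \<subseteq> M" if M: "M \<in> \<B>" for M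
    using I_unb[OF M] h I by blast
  then have Q: "?Q \<notin> \<B>" using gaps[OF hI] by blast
  have disjoint: "(h C - C) \<inter> (h (h D) - h D) = {}" if "C \<in> \<I>" "D \<in> \<I>" for C D
  proof -
    have "C \<in> \<C>" "D \<in> \<C>" using that I by blast+
    then have "C \<subseteq> h C" "D \<subseteq> h D" "h C \<subseteq> h (h C)" using h by blast+
    then show ?thesis using sparse[OF that] by blast
  qed
  have "?Q \<subseteq> X"
    using hI h sub bornology_on_carrier[OF born] by blast
  with disjoint have "?Q \<subseteq> X - ?P" by blast
  then have "X - ?P \<notin> \<B>"
    using Q bornology_on_subset[OF born] by blast
  moreover have "?P \<subseteq> X"
    using I h sub bornology_on_carrier[OF born] by blast
  ultimately show thesis using that P by blast
qed

section \<open>Linear bases\<close>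

text \<open>
  Read \<open>T\<close> as a comparison of rates: the elements \<open>q\<close> with \<open>T p q\<close> are those that \<open>p\<close> dominates.
  Each bounded set dominates only a bounded set, and each bounded set is dominated by all elements
  outside a bounded set.  If some element of \<open>G \<subseteq> Q\<close> escapes the set \<open>g A\<close> dominated by \<open>A\<close>, then
  \<open>A\<close> lies in the set \<open>f G\<close> of those that do not dominate all of \<open>G\<close>, so \<open>g A\<close> lies in
  \<open>g (f G)\<close>, a bound depending only on \<open>G\<close>.  This gives a cofinal chain on the side of \<open>Q\<close>, and the
  monotone map \<open>f\<close> carries it to the side of \<open>P\<close>.
\<close>

lemma linear_base_of_relation:
  assumes born: "bornology_on X \<B>" and PQ: "P \<union> Q = X" "P \<notin> \<B>" "Q \<notin> \<B>"
    and T_bounded: "\<And>A. A \<in> \<B> \<Longrightarrow> A \<subseteq> P \<Longrightarrow> {q \<in> Q. \<exists>p\<in>A. T p q} \<in> \<B>"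
    and T_cobounded: "\<And>B. B \<in> \<B> \<Longrightarrow> B \<subseteq> Q \<Longrightarrow> {p \<in> P. \<exists>q\<in>B. \<not> T p q} \<in> \<B>"
  shows "\<exists>\<L>. base_of \<L> \<B> \<and> (\<forall>A\<in>\<L>. \<forall>B\<in>\<L>. A \<subseteq> B \<or> B \<subseteq> A)"
proof -
  define g where "g A = {q \<in> Q. \<exists>p\<in>A. T p q}" for A
  define f where "f B = {p \<in> P. \<exists>q\<in>B. \<not> T p q}" for B
  define \<G> where "\<G> = g ` {A \<in> \<B>. A \<subseteq> P}"
  have G: "G \<in> \<B> \<and> G \<subseteq> Q" if "G \<in> \<G>" for G
    using that T_bounded by (auto simp: \<G>_def g_def)
  have f: "f B \<in> \<B>" "f B \<subseteq> P" if "B \<in> \<B>" "B \<subseteq> Q" for B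
    using that T_cobounded by (auto simp: f_def)
  have fg: "A \<subseteq> f B" if "A \<subseteq> P" "B \<subseteq> Q" "\<not> B \<subseteq> g A" for A B
    using that by (auto simp: f_def g_def)
  have g_Un: "g (A \<union> A') = g A \<union> g A'" for A A'
    by (auto simp: g_def)
  have near: "G \<subseteq> H \<or> H \<subseteq> g (f G)" if GH: "G \<in> \<G>" "H \<in> \<G>" for G H
  proof -
    obtain A where A: "H = g A" "A \<subseteq> P" using GH(2) by (auto simp: \<G>_def)
    have "H \<subseteq> g (f G)" if "\<not> G \<subseteq> H"
    proof -
      have "A \<subseteq> f G" using fg[OF A(2)] G[OF GH(1)] A(1) that by blast
      then show ?thesis unfolding A(1) g_def by blast
    qed
    then show ?thesis by blast
  qed
  have "g (f G) \<in> \<G>" if "G \<in> \<G>" for G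
    using f G[OF that] unfolding \<G>_def by blast
  moreover have "G \<union> H \<in> \<G>" if GH: "G \<in> \<G>" "H \<in> \<G>" for G H
  proof -
    obtain A A' where A: "A \<in> \<B>" "A \<subseteq> P" "G = g A" "A' \<in> \<B>" "A' \<subseteq> P" "H = g A'"
      using GH unfolding \<G>_def by blast
    then have "A \<union> A' \<in> \<B>" using bornology_on_Un[OF born] by blast
    with A show ?thesis unfolding \<G>_def using g_Un by blast
  qed
  ultimately obtain \<L> where L: "\<L> \<subseteq> \<G>"
    and chain: "\<And>L M. L \<in> \<L> \<Longrightarrow> M \<in> \<L> \<Longrightarrow> L \<subseteq> M \<or> M \<subseteq> L"
    and cofinal: "\<And>G. G \<in> \<G> \<Longrightarrow> \<exists>L\<in>\<L>. G \<subseteq> L"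
    using cofinal_chain_of_near_chain[of \<G> "\<lambda>G. g (f G)"] near by blast
  have cofinal_Q: "\<exists>L\<in>\<L>. B \<subseteq> L" if B: "B \<in> \<B>" "B \<subseteq> Q" for B
  proof -
    obtain p where p: "p \<in> P" "p \<notin> f B"
      using PQ(2) f[OF B] by (metis subsetI subset_antisym)
    have "{p} \<in> \<B>" using bornology_on_finite[OF born] p(1) PQ(1) by blast
    then have "g {p} \<in> \<G>" using p(1) unfolding \<G>_def by blast
    moreover have "B \<subseteq> g {p}" using fg[of "{p}" B] p B(2) by blast
    ultimately show ?thesis using cofinal[of "g {p}"] by blast
  qed
  have "\<exists>L\<in>\<L>. B \<subseteq> L \<union> f L" if B: "B \<in> \<B>" for B
  proof -
    let ?A = "B \<inter> P"
    have A: "?A \<in> \<B>" using bornology_on_subset[OF born B] by blast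
    then have gA: "g ?A \<in> \<B>" "g ?A \<subseteq> Q" using G unfolding \<G>_def by blast+
    \<comment> \<open>A point of \<open>Q\<close> that \<open>B \<inter> P\<close> does not dominate forces \<open>B \<inter> P\<close> into \<open>f L\<close>.\<close>
    obtain q where q: "q \<in> Q" "q \<notin> g ?A" using PQ(3) gA by (metis subsetI subset_antisym)
    have "B \<inter> Q \<in> \<B>" using bornology_on_subset[OF born B] by blast
    moreover have "{q} \<in> \<B>" using bornology_on_finite[OF born] q(1) PQ(1) by blast
    ultimately have "{q} \<union> B \<inter> Q \<in> \<B>" using bornology_on_Un[OF born] by blast
    then obtain L where "L \<in> \<L>" and BL: "{q} \<union> B \<inter> Q \<subseteq> L" using cofinal_Q q(1) by blast
    moreover have "?A \<subseteq> f L" using fg[of ?A L] q(2) BL G L \<open>L \<in> \<L>\<close> by blast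
    moreover have "B \<subseteq> P \<union> Q" using PQ(1) bornology_on_carrier[OF born B] by blast
    ultimately show ?thesis by blast
  qed
  moreover have "L \<union> f L \<in> \<B>" if "L \<in> \<L>" for L
    using bornology_on_Un[OF born] f G L that by blast
  ultimately have "base_of ((\<lambda>L. L \<union> f L) ` \<L>) \<B>"
    by (simp add: base_of_def image_subset_iff)
  moreover have "A \<subseteq> B \<or> B \<subseteq> A"
    if AB: "A \<in> (\<lambda>L. L \<union> f L) ` \<L>" "B \<in> (\<lambda>L. L \<union> f L) ` \<L>" for A B
  proof -
    have mono: "L \<union> f L \<subseteq> M \<union> f M" if "L \<subseteq> M" for L M
      using that by (auto simp: f_def)
    obtain L M where "L \<in> \<L>" "M \<in> \<L>" "A = L \<union> f L" "B = M \<union> f M"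
      using AB by (elim imageE)
    then show ?thesis
      using chain[of L M] mono[of L M] mono[of M L] by simp blast
  qed
  ultimately show ?thesis by (intro exI conjI ballI)
qed

lemma linear_base_of_normal:
  assumes born: "bornology_on X \<B>" and X: "X \<notin> \<B>" and normal: "normal_family \<B>"
  shows "\<exists>\<L>. base_of \<L> \<B> \<and> (\<forall>A\<in>\<L>. \<forall>B\<in>\<L>. A \<subseteq> B \<or> B \<subseteq> A)"
proof -
  obtain P where P: "P \<subseteq> X" "P \<notin> \<B>" "X - P \<notin> \<B>"
    using normal_splits[OF born X normal] .
  define Q where "Q = X - P"
  define singles where "singles S = (\<lambda>a. {a}) ` S" for S :: "'a set"
  have fin: "A \<in> \<B>" if "A \<subseteq> X" "finite A" for A
    using bornology_on_finite[OF born that] .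
  have "far \<B> (singles P) (singles Q)"
    unfolding far_def
  proof
    fix B assume "B \<in> \<B>"
    \<comment> \<open>Distinct singletons differ by their union.\<close>
    moreover have "y \<union> z \<subseteq> B" if "y \<in> singles P" "z \<in> singles Q" "sym_diff y z \<subseteq> B" for y z
      using that by (auto simp: singles_def Q_def)
    ultimately show "\<exists>C\<in>\<B>. \<forall>y\<in>singles P. \<forall>z\<in>singles Q. sym_diff y z \<subseteq> B \<longrightarrow> y \<union> z \<subseteq> C"
      by blast
  qed
  moreover have "singles P \<subseteq> \<B>" "singles Q \<subseteq> \<B>"
    using fin P(1) by (auto simp: singles_def Q_def)
  ultimately obtain U where UP: "surrounds \<B> U (singles P)" and UQ: "surrounds \<B> (- U) (singles Q)"
    using normal unfolding normal_family_def by blast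
  have pair: "{p, q} \<in> \<B>" if "p \<in> P" "q \<in> Q" for p q
    using fin that P(1) by (simp add: Q_def subset_iff)
  show ?thesis
  proof (rule linear_base_of_relation[OF born, of P Q "\<lambda>p q. {p, q} \<in> U"])
    show "P \<union> Q = X" "P \<notin> \<B>" "Q \<notin> \<B>"
      using P by (auto simp: Q_def)
  next
    fix A assume A: "A \<in> \<B>" "A \<subseteq> P"
    obtain C where C: "C \<in> \<B>"
      "\<And>y x. y \<in> singles Q \<Longrightarrow> x \<in> \<B> \<Longrightarrow> sym_diff x y \<subseteq> A \<Longrightarrow> x \<in> - U \<or> x \<subseteq> C"
      using surroundsE[OF UQ A(1)] by blast
    have "{q \<in> Q. \<exists>p\<in>A. {p, q} \<in> U} \<subseteq> C"
    proof
      fix q assume "q \<in> {q \<in> Q. \<exists>p\<in>A. {p, q} \<in> U}"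
      then obtain p where p: "q \<in> Q" "p \<in> A" "{p, q} \<in> U" by blast
      then have "{p, q} \<in> \<B>" "sym_diff {p, q} {q} \<subseteq> A" using pair A(2) by blast+
      then show "q \<in> C" using C(2)[of "{q}" "{p, q}"] p by (auto simp: singles_def)
    qed
    then show "{q \<in> Q. \<exists>p\<in>A. {p, q} \<in> U} \<in> \<B>"
      using bornology_on_subset[OF born C(1)] by blast
  next
    fix B assume B: "B \<in> \<B>" "B \<subseteq> Q"
    obtain C where C: "C \<in> \<B>"
      "\<And>y x. y \<in> singles P \<Longrightarrow> x \<in> \<B> \<Longrightarrow> sym_diff x y \<subseteq> B \<Longrightarrow> x \<in> U \<or> x \<subseteq> C"
      using surroundsE[OF UP B(1)] by blast
    have "{p \<in> P. \<exists>q\<in>B. {p, q} \<notin> U} \<subseteq> C"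
    proof
      fix p assume "p \<in> {p \<in> P. \<exists>q\<in>B. {p, q} \<notin> U}"
      then obtain q where q: "p \<in> P" "q \<in> B" "{p, q} \<notin> U" by blast
      then have "{p, q} \<in> \<B>" "sym_diff {p, q} {p} \<subseteq> B" using pair B(2) by blast+
      then show "p \<in> C" using C(2)[of "{p}" "{p, q}"] q by (auto simp: singles_def)
    qed
    then show "{p \<in> P. \<exists>q\<in>B. {p, q} \<notin> U} \<in> \<B>"
      using bornology_on_subset[OF born C(1)] by blast
  qed
qed

theorem theorem4p1:
  fixes \<kappa> :: "'a rel" and \<B> :: "'a set set"
  assumes "Card_order \<kappa>" and "infinite (Field \<kappa>)"
    and "bornology_on (Field \<kappa>) \<B>"
    and "Field \<kappa> \<notin> \<B>"
  shows "normal_ballean (macrocube \<kappa> \<B>) (macrocube_coarse \<kappa> \<B>) \<longleftrightarrow>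
    (\<exists>\<L>. base_of \<L> \<B> \<and> (\<forall>A\<in>\<L>. \<forall>B\<in>\<L>. A \<subseteq> B \<or> B \<subseteq> A))"
proof
  assume "normal_ballean (macrocube \<kappa> \<B>) (macrocube_coarse \<kappa> \<B>)"
  then have "normal_family \<B>"
    by (rule normal_family_of_normal_macrocube[OF assms(3)])
  then show "\<exists>\<L>. base_of \<L> \<B> \<and> (\<forall>A\<in>\<L>. \<forall>B\<in>\<L>. A \<subseteq> B \<or> B \<subseteq> A)"
    by (rule linear_base_of_normal[OF assms(3,4)])
next
  assume "\<exists>\<L>. base_of \<L> \<B> \<and> (\<forall>A\<in>\<L>. \<forall>B\<in>\<L>. A \<subseteq> B \<or> B \<subseteq> A)"
  then show "normal_ballean (macrocube \<kappa> \<B>) (macrocube_coarse \<kappa> \<B>)"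
    using normal_macrocube_of_linear_base[OF assms(3)] by (elim exE conjE)
qed

end
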